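(* Let $\mathcal{LSS}_X$ be a large scale structure on a set $X$. Let $\mathcal C$ be the set of all subsets $E\subset X\times X$ for which there is $\mathcal B\in\mathcal{LSS}_X$ such that $E\subset\bigcup_{B\in\mathcal B}B\times B$. Then $\mathcal C$ is a coarse structure on $X$.
   Context: For $B\subset X$ and a family $\mathcal U$ of subsets of $X$, the star $\mathrm{St}(B,\mathcal U)$ is the union of those elements of $\mathcal U$ that intersect $B$. For families $\mathcal B,\mathcal U$ of subsets of $X$, $\mathrm{St}(\mathcal B,\mathcal U)=\{\mathrm{St}(B,\mathcal U)\}_{B\in\mathcal B}$. A large scale structure $\mathcal{LSS}_X$ on a set $X$ is a non-empty set of families of subsets of $X$ (the uniformly bounded families) such that: (1) if $\mathcal B_1\in\mathcal{LSS}_X$ and $\mathcal B_2$ is a family of subsets of $X$ such that each element of $\mathcal B_2$ consisting of more than one point is contained in some element of $\mathcal B_1$, then $\mathcal B_2\in\mathcal{LSS}_X$; (2) $\mathcal B_1,\mathcal B_2\in\mathcal{LSS}_X$ implies $\mathrm{St}(\mathcal B_1,\mathcal B_2)\in\mathcal{LSS}_X$. A coarse structure $\mathcal C$ on $X$ is a family of subsets of $X\times X$ (called controlled sets) such that: (1) the diagonal $\Delta=\{(x,x)\}_{x\in X}$ belongs to $\mathcal C$; (2) $E_1\in\mathcal C$ and $E_2\subset E_1$ imply $E_2\in\mathcal C$; (3) $E\in\mathcal C$ implies $E^{-1}=\{(y,x)\mid(x,y)\in E\}\in\mathcal C$; (4) $E_1,E_2\in\mathcal C$ implies $E_1\cup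 E_2\in\mathcal C$; (5) $E,F\in\mathcal C$ implies $E\circ F\in\mathcal C$, where $E\circ F$ consists of all $(x,y)$ such that there is $z\in X$ with $(x,z)\in E$ and $(z,y)\in F$. *)

theory Defs
  imports Main
begin

definition star :: "'a set \<Rightarrow> 'a set set \<Rightarrow> 'a set" where
  "star B \<U> = \<Union>{U \<in> \<U>. U \<inter> B \<noteq> {}}"

definition star_family :: "'a set set \<Rightarrow> 'a set set \<Rightarrow> 'a set set" where
  "star_family \<B> \<U> = (\<lambda>B. star B \<U>) ` \<B>"

definition large_scale_structure :: "'a set \<Rightarrow> 'a set set set \<Rightarrow> bool" where
  "large_scale_structure X \<L> \<longleftrightarrow>
     \<L> \<subseteq> Pow (Pow X) \<and> \<L> \<noteq> {} \<and>
     (\<forall>\<B>\<^sub>1 \<in> \<L>. \<forall>\<B>\<^sub>2. \<B>\<^sub>2 \<subseteq> Pow X \<longrightarrow>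
        (\<forall>B \<in> \<B>\<^sub>2. (\<exists>x \<in> B. \<exists>y \<in> B. x \<noteq> y) \<longrightarrow> (\<exists>B' \<in> \<B>\<^sub>1. B \<subseteq> B')) \<longrightarrow> \<B>\<^sub>2 \<in> \<L>) \<and>
     (\<forall>\<B>\<^sub>1 \<in> \<L>. \<forall>\<B>\<^sub>2 \<in> \<L>. star_family \<B>\<^sub>1 \<B>\<^sub>2 \<in> \<L>)"

(* The library's relational composition E O F has the required order:
   (x, y) is in E O F iff (x, z) is in E and (z, y) is in F for some z. *)
definition coarse_structure :: "'a set \<Rightarrow> ('a \<times> 'a) set set \<Rightarrow> bool" where
  "coarse_structure X \<C> \<longleftrightarrow>
     \<C> \<subseteq> Pow (X \<times> X) \<and>
     Id_on X \<in> \<C> \<and>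
     (\<forall>E\<^sub>1 \<in> \<C>. \<forall>E\<^sub>2. E\<^sub>2 \<subseteq> E\<^sub>1 \<longrightarrow> E\<^sub>2 \<in> \<C>) \<and>
     (\<forall>E \<in> \<C>. converse E \<in> \<C>) \<and>
     (\<forall>E\<^sub>1 \<in> \<C>. \<forall>E\<^sub>2 \<in> \<C>. E\<^sub>1 \<union> E\<^sub>2 \<in> \<C>) \<and>
     (\<forall>E \<in> \<C>. \<forall>F \<in> \<C>. E O F \<in> \<C>)"

end

(* A uniformly bounded family stays so after all singletons are added. For such padded families,
   one element of St(B1, B2) contains B \<union> C whenever B in B1 and C in B2 meet. This handles
   compositions, and also unions since B and C may be singletons. *)
theory Submission
  imports Defs
begin

lemma large_scale_structure_subset:
  assumes "large_scale_structure X \<L>" "\<B> \<in> \<L>" "B \<in> \<B>"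
  shows "B \<subseteq> X"
proof -
  have "\<L> \<subseteq> Pow (Pow X)"
    using assms(1) by (simp add: large_scale_structure_def)
  with assms(2,3) show ?thesis
    by blast
qed

lemma large_scale_structure_star_family:
  assumes "large_scale_structure X \<L>" "\<B> \<in> \<L>" "\<C> \<in> \<L>"
  shows "star_family \<B> \<C> \<in> \<L>"
  using assms by (simp add: large_scale_structure_def)

text \<open>The first closure condition tests only elements with at least two points. Added
  singletons therefore pass for free, and each element of \<open>\<B>\<close> is contained in
  itself. The padded family covers \<open>X\<close>, which \<open>\<B>\<close> alone need not
  do.\<close>

lemma large_scale_structure_add_singletons:
  assumes L: "large_scale_structure X \<L>" and B: "\<B> \<in> \<L>"
  shows "\<B> \<union> (\<lambda>x. {x}) ` X \<in> \<L>"
proof -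
  let ?\<B>' = "\<B> \<union> (\<lambda>x. {x}) ` X"
  have "?\<B>' \<subseteq> Pow X"
    using large_scale_structure_subset[OF L B] by auto
  moreover have "\<forall>B \<in> ?\<B>'. (\<exists>x \<in> B. \<exists>y \<in> B. x \<noteq> y) \<longrightarrow> (\<exists>B' \<in> \<B>. B \<subseteq> B')"
    by auto
  ultimately show ?thesis
    using L B unfolding large_scale_structure_def by (elim conjE) (drule bspec, assumption, simp)
qed

text \<open>The witness is the star family of the two padded families: the star of \<open>B\<close>
  absorbs every \<open>C\<close> that meets \<open>B\<close>. It depends only on \<open>\<B>\<close>
  and \<open>\<C>\<close>, so a single \<open>\<D>\<close> serves all pairs at once, including those
  in which \<open>B\<close> or \<open>C\<close> is a singleton.\<close>

lemma large_scale_structure_join: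
  assumes L: "large_scale_structure X \<L>" and B: "\<B> \<in> \<L>" and C: "\<C> \<in> \<L>"
  shows "\<exists>\<D> \<in> \<L>. \<forall>B \<in> \<B> \<union> (\<lambda>x. {x}) ` X. \<forall>C \<in> \<C> \<union> (\<lambda>x. {x}) ` X.
    B \<inter> C \<noteq> {} \<longrightarrow> (\<exists>D \<in> \<D>. B \<union> C \<subseteq> D)"
proof (rule bexI, intro ballI impI)
  let ?\<B>' = "\<B> \<union> (\<lambda>x. {x}) ` X" and ?\<C>' = "\<C> \<union> (\<lambda>x. {x}) ` X"
  show "star_family ?\<B>' ?\<C>' \<in> \<L>"
    by (intro large_scale_structure_star_family[OF L] large_scale_structure_add_singletons[OF L] B C)
  fix B C
  assume BC: "B \<in> ?\<B>'" "C \<in> ?\<C>'" "B \<inter> C \<noteq> {}"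
  have "B \<subseteq> X"
    using BC(1) large_scale_structure_subset[OF L B] by blast
  \<comment> \<open>This uses the padding of the second family: for each \<open>b\<close> in
    \<open>B\<close>, the singleton \<open>{b}\<close> belongs to it and meets
    \<open>B\<close>.\<close>
  then have "B \<subseteq> star B ?\<C>'"
    unfolding star_def by blast
  moreover have "C \<subseteq> star B ?\<C>'"
    using BC unfolding star_def by blast
  moreover have "star B ?\<C>' \<in> star_family ?\<B>' ?\<C>'"
    using BC(1) unfolding star_family_def by (rule imageI)
  ultimately show "\<exists>D \<in> star_family ?\<B>' ?\<C>'. B \<union> C \<subseteq> D"
    by blast
qed

theorem proposition2p4:
  fixes X :: "'a set" and \<L> :: "'a set set set"
  assumes "large_scale_structure X \<L>"
  shows "coarse_structure X {E. E \<subseteq> X \<times> X \<and> (\<exists>\<B> \<in> \<L>. E \<subseteq> (\<Union>B \<in> \<B>. B \<times> B))}"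
proof -
  define \<E> where "\<E> = {E. E \<subseteq> X \<times> X \<and> (\<exists>\<B> \<in> \<L>. E \<subseteq> (\<Union>B \<in> \<B>. B \<times> B))}"
  have mem: "E \<in> \<E> \<longleftrightarrow> E \<subseteq> X \<times> X \<and> (\<exists>\<B> \<in> \<L>. E \<subseteq> (\<Union>B \<in> \<B>. B \<times> B))" for E
    by (simp add: \<E>_def)
  have diagonal: "Id_on X \<in> \<E>"
  proof -
    have "\<L> \<noteq> {}"
      using assms by (simp add: large_scale_structure_def)
    then obtain \<B> where "\<B> \<in> \<L>"
      by blast
    then have "\<B> \<union> (\<lambda>x. {x}) ` X \<in> \<L>"
      by (rule large_scale_structure_add_singletons[OF assms])
    \<comment> \<open>The pair \<open>(x, x)\<close> lies in the square of the added singleton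
      \<open>{x}\<close>.\<close>
    moreover have "Id_on X \<subseteq> X \<times> X" "Id_on X \<subseteq> (\<Union>B \<in> \<B> \<union> (\<lambda>x. {x}) ` X. B \<times> B)"
      by auto
    ultimately show ?thesis
      unfolding mem by (intro conjI bexI)
  qed
  \<comment> \<open>Union and composition are treated together because the same family
    \<open>\<D>\<close> controls \<open>E\<close>, \<open>F\<close> and
    \<open>E O F\<close>.\<close>
  have union_comp: "E \<union> F \<in> \<E> \<and> E O F \<in> \<E>" if "E \<in> \<E>" "F \<in> \<E>" for E F
  proof -
    have EF: "E \<subseteq> X \<times> X" "F \<subseteq> X \<times> X"
      using that by (simp_all add: mem)
    obtain \<B> where B: "\<B> \<in> \<L>" "E \<subseteq> (\<Union>B \<in> \<B>. B \<times> B)"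
      using \<open>E \<in> \<E>\<close> unfolding mem by (elim conjE bexE)
    obtain \<C> where C: "\<C> \<in> \<L>" "F \<subseteq> (\<Union>C \<in> \<C>. C \<times> C)"
      using \<open>F \<in> \<E>\<close> unfolding mem by (elim conjE bexE)
    obtain \<D> where D: "\<D> \<in> \<L>"
      and join: "\<forall>B \<in> \<B> \<union> (\<lambda>x. {x}) ` X. \<forall>C \<in> \<C> \<union> (\<lambda>x. {x}) ` X.
        B \<inter> C \<noteq> {} \<longrightarrow> (\<exists>D \<in> \<D>. B \<union> C \<subseteq> D)"
      using large_scale_structure_join[OF assms B(1) C(1)] by (elim bexE)
    have "E \<subseteq> (\<Union>D \<in> \<D>. D \<times> D)"
    proof
      fix p
      assume "p \<in> E"
      obtain x y B where "p = (x, y)" "x \<in> X" "B \<in> \<B>" "x \<in> B" "y \<in> B"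
        using B(2) EF(1) \<open>p \<in> E\<close> by blast
      then show "p \<in> (\<Union>D \<in> \<D>. D \<times> D)"
        \<comment> \<open>As \<open>x\<close> lies in \<open>B\<close>, joining \<open>B\<close>
          with \<open>{x}\<close> just gives an element of \<open>\<D>\<close> containing
          \<open>B\<close>, hence both coordinates of \<open>p\<close>.\<close>
        using join[rule_format, of B "{x}"] by auto
    qed
    moreover have "F \<subseteq> (\<Union>D \<in> \<D>. D \<times> D)"
    proof
      fix p
      assume "p \<in> F"
      obtain x y C where "p = (x, y)" "x \<in> X" "C \<in> \<C>" "x \<in> C" "y \<in> C"
        using C(2) EF(2) \<open>p \<in> F\<close> by blast
      then show "p \<in> (\<Union>D \<in> \<D>. D \<times> D)"
        \<comment> \<open>Now the singleton is taken from the first padded family, since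
          \<open>C\<close> comes from the second.\<close>
        using join[rule_format, of "{x}" C] by auto
    qed
    moreover have "E O F \<subseteq> (\<Union>D \<in> \<D>. D \<times> D)"
    proof
      fix p
      assume "p \<in> E O F"
      obtain x y z where p: "p = (x, y)" "(x, z) \<in> E" "(z, y) \<in> F"
        using \<open>p \<in> E O F\<close> by blast
      then obtain B C where "B \<in> \<B>" "x \<in> B" "z \<in> B" "C \<in> \<C>" "z \<in> C" "y \<in> C"
        using B(2) C(2) by blast
      \<comment> \<open>The intermediate point \<open>z\<close> lies in \<open>B \<inter> C\<close>,
        so some element of \<open>\<D>\<close> contains \<open>B \<union> C\<close> and with it
        \<open>x\<close> and \<open>y\<close>.\<close>
      then show "p \<in> (\<Union>D \<in> \<D>. D \<times> D)"
        using join[rule_format, of B C] p(1) by blast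
    qed
    ultimately have "E \<union> F \<subseteq> (\<Union>D \<in> \<D>. D \<times> D)" "E O F \<subseteq> (\<Union>D \<in> \<D>. D \<times> D)"
      by (simp_all only: Un_least)
    moreover have "E \<union> F \<subseteq> X \<times> X" "E O F \<subseteq> X \<times> X"
      using EF by blast+
    ultimately show ?thesis
      using D unfolding mem by (intro conjI bexI)
  qed
  have subset: "E' \<in> \<E>" if "E \<in> \<E>" "E' \<subseteq> E" for E E'
    using that unfolding mem by (elim conjE bexE) (intro conjI bexI; (rule subset_trans)?; assumption)
  have converse: "E\<inverse> \<in> \<E>" if E: "E \<in> \<E>" for E
  proof -
    obtain \<B> where "\<B> \<in> \<L>" "E \<subseteq> (\<Union>B \<in> \<B>. B \<times> B)" "E \<subseteq> X \<times> X"
      using E unfolding mem by (elim conjE bexE)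
    \<comment> \<open>Each square \<open>B \<times> B\<close> is symmetric, so the family for
      \<open>E\<close> also serves its converse.\<close>
    moreover from this have "E\<inverse> \<subseteq> (\<Union>B \<in> \<B>. B \<times> B)" "E\<inverse> \<subseteq> X \<times> X"
      by blast+
    ultimately show ?thesis
      unfolding mem by (intro conjI bexI)
  qed
  have carrier: "\<E> \<subseteq> Pow (X \<times> X)"
    unfolding \<E>_def by blast
  have "coarse_structure X \<E>"
    unfolding coarse_structure_def
    by (intro conjI ballI allI impI)
      (rule carrier diagonal converse union_comp[THEN conjunct1] union_comp[THEN conjunct2] subset; assumption)+
  then show ?thesis
    unfolding \<E>_def .
qed

end
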